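(* Let $(S,d_S)$ be a separable metric space with Borel $\sigma$-algebra $\mathcal S$, and let $\mathbf B=\{B_r(x):x\in S,\ r>0\}$ be the collection of its open balls. Then the linear span of $\{1_B:B\in\mathbf B\}$ is dense in $L^1(S,\mathcal S,\mu)$ for every Borel probability measure $\mu$ on $S$ if and only if $\mathbf B$ forms a separating class.
   Context: $B_r(x)=\{y\in S:d_S(x,y)<r\}$. The collection $\mathbf B$ forms a separating class if, for any two Borel probability measures $\mu_1,\mu_2$ on $S$, $\mu_1(B)=\mu_2(B)$ for all $B\in\mathbf B$ implies $\mu_1=\mu_2$. *)

theory Defs
  imports "HOL-Probability.Probability" "HOL-Library.Function_Algebras"
begin

definition open_balls :: "'a::metric_space set set" where
  "open_balls = {ball x r | x r. r > 0}"

definition borel_prob :: "'a::topological_space measure \<Rightarrow> bool" where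
  "borel_prob M \<longleftrightarrow> sets M = sets borel \<and> prob_space M"

definition separating_class :: "'a::topological_space set set \<Rightarrow> bool" where
  "separating_class \<B> \<longleftrightarrow>
     (\<forall>M N. borel_prob M \<longrightarrow> borel_prob N \<longrightarrow>
        (\<forall>B\<in>\<B>. measure M B = measure N B) \<longrightarrow> M = N)"

abbreviation fun_scale :: "real \<Rightarrow> ('a \<Rightarrow> real) \<Rightarrow> 'a \<Rightarrow> real" where
  "fun_scale c f \<equiv> (\<lambda>x. c * f x)"

lemma module_fun_scale: "module (fun_scale :: real \<Rightarrow> ('a \<Rightarrow> real) \<Rightarrow> 'a \<Rightarrow> real)"
  by unfold_locales (auto simp: fun_eq_iff algebra_simps)

(* The library has no real_vector instance for the function type, so the linear span of the
   indicators is taken in the module of all functions with pointwise operations. *)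
definition indicator_span :: "'a set set \<Rightarrow> ('a \<Rightarrow> real) set" where
  "indicator_span \<B> = module.span fun_scale (indicator ` \<B>)"

(* L1 is represented by integrable functions with the seminorm \<integral> \<bar>f\<bar>, not by classes of functions
   modulo equality almost everywhere; density does not depend on the choice. *)
definition dense_in_L1 :: "'a measure \<Rightarrow> ('a \<Rightarrow> real) set \<Rightarrow> bool" where
  "dense_in_L1 M V \<longleftrightarrow>
     V \<subseteq> {f. integrable M f} \<and>
     (\<forall>f. integrable M f \<longrightarrow> (\<forall>e>0. \<exists>g\<in>V. (\<integral>x. \<bar>f x - g x\<bar> \<partial>M) < e))"

end

theory Submission
  imports Defs
begin

text \<open>
  Density implies separation because an \<open>L\<^sup>1\<close> approximation can be made for two measures at once.
  If \<open>M\<close> and \<open>N\<close> agree on a class of sets, they integrate every function in the span of its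
  indicators equally. Approximating \<open>indicator A\<close> from the span in \<open>L\<^sup>1\<close> of the average
  \<open>(M + N) / 2\<close> approximates it in \<open>L\<^sup>1 M\<close> and in \<open>L\<^sup>1 N\<close> by the same function, so
  \<open>M A = N A\<close> (\<open>separating_if_dense\<close>).

  For the converse, suppose that the span \<open>V\<close> is not dense in \<open>L\<^sup>1 M\<close>. The textbook argument takes
  a functional that vanishes on \<open>V\<close> from the Hahn-Banach theorem and represents it by a bounded
  function. Orthogonal projection gives a substitute that needs less: functions in \<open>V\<close> and
  indicators are bounded, hence in \<open>L\<^sup>2\<close>, and on a probability space the \<open>L\<^sup>1\<close> norm is at most the
  \<open>L\<^sup>2\<close> norm. An indicator \<open>f\<close> that stays away from \<open>V\<close> in \<open>L\<^sup>1\<close> therefore stays away from it in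
  \<open>L\<^sup>2\<close>, and the residuals \<open>f - g n\<close> of a sequence in \<open>V\<close> minimising the \<open>L\<^sup>2\<close> distance converge
  to some \<open>w\<close> that is orthogonal to \<open>V\<close> but not to \<open>f\<close>. Convergence is only used in \<open>L\<^sup>1\<close>, which
  suffices for testing against bounded functions (\<open>L1_annihilator\<close>).

  Orthogonality to \<open>V\<close> says that the finite measures with densities \<open>max w 0\<close> and \<open>max (- w) 0\<close>
  agree on all balls. The space is an increasing union of balls, so their total masses agree as
  well, and after division by this mass they are probability measures that agree on all balls. If
  the balls separate probability measures, these two are equal, so \<open>w\<close> integrates to zero over
  every Borel set (\<open>zero_on_borel_if_zero_on_balls\<close>), contrary to its not being orthogonal
  to \<open>f\<close>.
\<close>

section \<open>Completeness of L1\<close>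

text \<open>
  A subsequence converges almost everywhere. Its pointwise limit is the limit in mean by Fatou's
  lemma, applied along the subsequence to the distance from a fixed member of the sequence.
\<close>

lemma L1_Cauchy_converges:
  fixes s :: "nat \<Rightarrow> 'a \<Rightarrow> real"
  assumes s: "\<And>n. integrable M (s n)"
    and Cau: "\<And>e. e > 0 \<Longrightarrow> \<exists>N. \<forall>i\<ge>N. \<forall>j\<ge>N. (\<integral>x. \<bar>s i x - s j x\<bar> \<partial>M) < e"
  obtains w where "integrable M w" "(\<lambda>n. \<integral>x. \<bar>s n x - w x\<bar> \<partial>M) \<longlonglongrightarrow> 0"
proof -
  have [measurable]: "\<And>n. s n \<in> borel_measurable M" using s by auto
  obtain r where r: "strict_mono r" and ae: "AE x in M. Cauchy (\<lambda>i. s (r i) x)"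
    using cauchy_L1_AE_cauchy_subseq[of M s] s Cau by auto
  define w where "w x = lim (\<lambda>i. s (r i) x)" for x
  have [measurable]: "w \<in> borel_measurable M"
    unfolding w_def by (rule borel_measurable_lim_metric) simp
  have ae_lim: "AE x in M. (\<lambda>i. s (r i) x) \<longlonglongrightarrow> w x"
    using ae by eventually_elim (simp add: w_def Cauchy_convergent_iff convergent_LIMSEQ_iff)
  have fatou: "(\<integral>\<^sup>+x. ennreal \<bar>s n x - w x\<bar> \<partial>M) \<le> ennreal e"
    if N: "\<forall>i\<ge>N. \<forall>j\<ge>N. (\<integral>x. \<bar>s i x - s j x\<bar> \<partial>M) < e" and n: "n \<ge> N" for N n e
  proof -
    have "(\<integral>\<^sup>+x. ennreal \<bar>s n x - w x\<bar> \<partial>M)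
        = (\<integral>\<^sup>+x. liminf (\<lambda>i. ennreal \<bar>s n x - s (r i) x\<bar>) \<partial>M)"
    proof (rule nn_integral_cong_AE)
      show "AE x in M. ennreal \<bar>s n x - w x\<bar> = liminf (\<lambda>i. ennreal \<bar>s n x - s (r i) x\<bar>)"
        using ae_lim
      proof eventually_elim
        case (elim x)
        have "(\<lambda>i. ennreal \<bar>s n x - s (r i) x\<bar>) \<longlonglongrightarrow> ennreal \<bar>s n x - w x\<bar>"
          by (intro tendsto_ennrealI tendsto_rabs tendsto_diff tendsto_const elim)
        then show ?case by (rule lim_imp_Liminf[OF trivial_limit_sequentially, symmetric])
      qed
    qed
    also have "\<dots> \<le> liminf (\<lambda>i. \<integral>\<^sup>+x. ennreal \<bar>s n x - s (r i) x\<bar> \<partial>M)"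
      by (rule nn_integral_liminf) simp
    also have "\<dots> \<le> ennreal e"
    proof (rule Liminf_le)
      show "\<forall>\<^sub>F i in sequentially. (\<integral>\<^sup>+x. ennreal \<bar>s n x - s (r i) x\<bar> \<partial>M) \<le> ennreal e"
        using eventually_ge_at_top[of N]
      proof eventually_elim
        case (elim i)
        then have "r i \<ge> N" using seq_suble[OF r, of i] by linarith
        then have "(\<integral>x. \<bar>s n x - s (r i) x\<bar> \<partial>M) < e" using N n by blast
        then show ?case using s by (subst nn_integral_eq_integral) (auto intro!: ennreal_leI)
      qed
    qed simp
    finally show ?thesis .
  qed
  have int_diff: "integrable M (\<lambda>x. s n x - w x)"
    if "\<forall>i\<ge>N. \<forall>j\<ge>N. (\<integral>x. \<bar>s i x - s j x\<bar> \<partial>M) < e" "n \<ge> N" for N n e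
  proof (rule integrableI_bounded)
    show "(\<integral>\<^sup>+x. ennreal (norm (s n x - w x)) \<partial>M) < \<infinity>"
      using fatou[OF that] by (auto intro: order.strict_trans1 simp: ennreal_less_top)
  qed simp
  obtain N where N: "\<forall>i\<ge>N. \<forall>j\<ge>N. (\<integral>x. \<bar>s i x - s j x\<bar> \<partial>M) < 1"
    using Cau[of 1] by auto
  have w: "integrable M w"
    using Bochner_Integration.integrable_diff[OF s[of N] int_diff[OF N order_refl]] by simp
  moreover have "(\<lambda>n. \<integral>x. \<bar>s n x - w x\<bar> \<partial>M) \<longlonglongrightarrow> 0"
  proof (rule LIMSEQ_I)
    fix e :: real assume "e > 0"
    then obtain N where N: "\<forall>i\<ge>N. \<forall>j\<ge>N. (\<integral>x. \<bar>s i x - s j x\<bar> \<partial>M) < e / 2"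
      using Cau[of "e / 2"] by auto
    have "norm ((\<integral>x. \<bar>s n x - w x\<bar> \<partial>M) - 0) < e" if "n \<ge> N" for n
    proof -
      have "ennreal (\<integral>x. \<bar>s n x - w x\<bar> \<partial>M) \<le> ennreal (e / 2)"
        using fatou[OF N that] s w by (subst (asm) nn_integral_eq_integral) auto
      then show ?thesis using \<open>e > 0\<close> by (simp add: ennreal_le_iff)
    qed
    then show "\<exists>N. \<forall>n\<ge>N. norm ((\<integral>x. \<bar>s n x - w x\<bar> \<partial>M) - 0) < e" by blast
  qed
  ultimately show ?thesis by (rule that)
qed

section \<open>Bounded measurable functions\<close>

definition bounded_measurable :: "'a measure \<Rightarrow> ('a \<Rightarrow> real) \<Rightarrow> bool" where
  "bounded_measurable M f \<longleftrightarrow> f \<in> borel_measurable M \<and> (\<exists>C. \<forall>x. \<bar>f x\<bar> \<le> C)"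

lemma bounded_measurable_mult:
  assumes "bounded_measurable M f" "bounded_measurable M g"
  shows "bounded_measurable M (\<lambda>x. f x * g x)"
proof -
  obtain C D where "\<And>x. \<bar>f x\<bar> \<le> C" "\<And>x. \<bar>g x\<bar> \<le> D"
    using assms unfolding bounded_measurable_def by blast
  then have "\<bar>f x * g x\<bar> \<le> C * D" for x
    unfolding abs_mult by (meson abs_ge_zero mult_mono order_trans)
  moreover have "(\<lambda>x. f x * g x) \<in> borel_measurable M"
    using assms by (intro borel_measurable_times) (simp_all add: bounded_measurable_def)
  ultimately show ?thesis unfolding bounded_measurable_def by blast
qed

lemma bounded_measurable_const: "bounded_measurable M (\<lambda>x. c)"
  by (auto simp: bounded_measurable_def)

lemma bounded_measurable_add:
  assumes "bounded_measurable M f" "bounded_measurable M g"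
  shows "bounded_measurable M (\<lambda>x. f x + g x)"
proof -
  obtain C D where *: "\<And>x. \<bar>f x\<bar> \<le> C" "\<And>x. \<bar>g x\<bar> \<le> D"
    using assms unfolding bounded_measurable_def by blast
  have "\<bar>f x + g x\<bar> \<le> C + D" for x
    using *[of x] by linarith
  moreover have "(\<lambda>x. f x + g x) \<in> borel_measurable M"
    using assms by (intro borel_measurable_add) (simp_all add: bounded_measurable_def)
  ultimately show ?thesis unfolding bounded_measurable_def by blast
qed

lemma bounded_measurable_diff:
  assumes "bounded_measurable M f" "bounded_measurable M g"
  shows "bounded_measurable M (\<lambda>x. f x - g x)"
  using bounded_measurable_add[OF assms(1)
      bounded_measurable_mult[OF bounded_measurable_const[of M "-1"] assms(2)]] by simp

lemma bounded_measurable_indicator: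
  "A \<in> sets M \<Longrightarrow> bounded_measurable M (indicator A)"
  unfolding bounded_measurable_def by (auto intro!: exI[of _ 1] simp: indicator_def)

lemma integrable_mult_bounded_measurable:
  assumes "integrable M w" "bounded_measurable M f"
  shows "integrable M (\<lambda>x. w x * f x)"
proof -
  obtain C where C: "\<And>x. \<bar>f x\<bar> \<le> C" using assms unfolding bounded_measurable_def by blast
  have [measurable]: "f \<in> borel_measurable M" "w \<in> borel_measurable M"
    using assms by (simp_all add: bounded_measurable_def)
  have bound: "norm (w x * f x) \<le> norm (C * w x)" for x
  proof -
    have "\<bar>f x\<bar> \<le> \<bar>C\<bar>" using C[of x] by linarith
    from mult_right_mono[OF this, of "\<bar>w x\<bar>"] show ?thesis by (simp add: abs_mult mult.commute)
  qed
  show ?thesis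
  proof (rule Bochner_Integration.integrable_bound)
    show "integrable M (\<lambda>x. C * w x)" using assms(1) by simp
    show "AE x in M. norm (w x * f x) \<le> norm (C * w x)" by (rule AE_I2) (rule bound)
  qed measurable
qed

section \<open>Orthogonal projection onto a space of bounded functions\<close>

context prob_space
begin

lemma bounded_measurable_integrable: "bounded_measurable M f \<Longrightarrow> integrable M f"
  using integrable_mult_bounded_measurable[of M "\<lambda>x. 1" f] by simp

text \<open>This is nonnegativity of the variance of \<open>\<bar>h\<bar>\<close>.\<close>

lemma L1_norm_le_L2_norm:
  assumes "bounded_measurable M h"
  shows "(\<integral>x. \<bar>h x\<bar> \<partial>M)\<^sup>2 \<le> (\<integral>x. h x * h x \<partial>M)"
proof -
  define m where "m = (\<integral>x. \<bar>h x\<bar> \<partial>M)"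
  have [simp]: "integrable M h" "integrable M (\<lambda>x. h x * h x)"
    using assms by (auto intro: bounded_measurable_integrable bounded_measurable_mult)
  have "0 \<le> (\<integral>x. (\<bar>h x\<bar> - m)\<^sup>2 \<partial>M)" by simp
  also have "\<dots> = (\<integral>x. h x * h x - 2 * m * \<bar>h x\<bar> + m\<^sup>2 \<partial>M)"
    by (intro Bochner_Integration.integral_cong refl) (simp add: power2_eq_square algebra_simps)
  also have "\<dots> = (\<integral>x. h x * h x \<partial>M) - 2 * m * m + m\<^sup>2"
    by (simp add: prob_space flip: m_def)
  finally show ?thesis by (simp add: m_def power2_eq_square)
qed

text \<open>
  A separation theorem that takes the place of Hahn-Banach: \<open>w\<close> is what remains of \<open>f\<close> after
  subtracting its \<open>L\<^sup>2\<close> projection onto the closure of \<open>V\<close>. Minimality of the distance makes the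
  residuals \<open>u n\<close> of a minimising sequence almost orthogonal to \<open>V\<close>, and the parallelogram identity
  makes them a Cauchy sequence.
\<close>

lemma L1_annihilator:
  fixes f :: "'a \<Rightarrow> real"
  assumes f: "bounded_measurable M f"
    and V: "\<And>g. g \<in> V \<Longrightarrow> bounded_measurable M g" "V \<noteq> {}"
    and lin: "\<And>g h c d. g \<in> V \<Longrightarrow> h \<in> V \<Longrightarrow> (\<lambda>x. c * g x + d * h x) \<in> V"
    and far: "e > 0" "\<And>g. g \<in> V \<Longrightarrow> e \<le> (\<integral>x. \<bar>f x - g x\<bar> \<partial>M)"
  obtains w where "integrable M w" "\<And>g. g \<in> V \<Longrightarrow> (\<integral>x. w x * g x \<partial>M) = 0"
    "(\<integral>x. w x * f x \<partial>M) > 0"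
proof -
  note bm = bounded_measurable_diff bounded_measurable_add bounded_measurable_mult
    bounded_measurable_const f V(1)
  note [simp] = bounded_measurable_integrable
  define ip where "ip g h = (\<integral>x. g x * h x \<partial>M)" for g h :: "'a \<Rightarrow> real"
  \<comment> \<open>the square of the \<open>L\<^sup>2\<close> distance from \<open>f\<close> to \<open>V\<close>\<close>
  define d where "d = (INF g\<in>V. ip (\<lambda>x. f x - g x) (\<lambda>x. f x - g x))"
  have bdd: "bdd_below ((\<lambda>g. ip (\<lambda>x. f x - g x) (\<lambda>x. f x - g x)) ` V)"
    by (rule bdd_belowI[of _ 0]) (auto simp: ip_def)
  have d_le: "d \<le> ip (\<lambda>x. f x - g x) (\<lambda>x. f x - g x)" if "g \<in> V" for g
    unfolding d_def by (rule cINF_lower[OF bdd that])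
  have "e\<^sup>2 \<le> ip (\<lambda>x. f x - g x) (\<lambda>x. f x - g x)" if "g \<in> V" for g
  proof -
    have "e\<^sup>2 \<le> (\<integral>x. \<bar>f x - g x\<bar> \<partial>M)\<^sup>2" using far(1) far(2)[OF that] by (intro power_mono) auto
    also have "\<dots> \<le> ip (\<lambda>x. f x - g x) (\<lambda>x. f x - g x)"
      unfolding ip_def using that by (intro L1_norm_le_L2_norm bm)
    finally show ?thesis .
  qed
  then have "e\<^sup>2 \<le> d" unfolding d_def by (intro cINF_greatest V(2))
  with far(1) have d_pos: "d > 0" by (smt (verit) zero_less_power)

  have "\<exists>g\<in>V. ip (\<lambda>x. f x - g x) (\<lambda>x. f x - g x) < d + inverse (Suc n)" for n
    using cINF_less_iff[OF V(2) bdd, of "d + inverse (Suc n)"] unfolding d_def by simp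
  then obtain g where gV: "\<And>n. g n \<in> V"
    and g: "\<And>n. ip (\<lambda>x. f x - g n x) (\<lambda>x. f x - g n x) < d + inverse (Suc n)"
    by metis
  define u where "u = (\<lambda>n x. f x - g n x)"
  define \<epsilon> where "\<epsilon> n = inverse (real (Suc n))" for n
  have \<epsilon>: "\<epsilon> \<longlonglongrightarrow> 0" unfolding \<epsilon>_def by (rule LIMSEQ_inverse_real_of_nat)
  have \<epsilon>_pos: "\<epsilon> n > 0" for n by (simp add: \<epsilon>_def)
  have u_bm: "bounded_measurable M (u n)" for n
    unfolding u_def by (intro bm gV)
  have u_lt: "ip (u n) (u n) < d + \<epsilon> n" for n
    using g[of n] by (simp add: u_def \<epsilon>_def)
  have u_ge: "d \<le> ip (u n) (u n)" for n
    using d_le[OF gV[of n]] by (simp add: u_def)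

  \<comment> \<open>Moving \<open>u n\<close> along \<open>v\<close> stays in \<open>f - V\<close>, so it can lower the squared norm by at most \<open>\<epsilon> n\<close>.
     The best step \<open>t\<close> lowers it by the square of the inner product divided by \<open>ip v v\<close>.\<close>
  have almost_orth: "(ip (u n) v)\<^sup>2 \<le> \<epsilon> n * ip v v" if v: "v \<in> V" for n v
  proof -
    have int: "integrable M (\<lambda>x. u n x * u n x)" "integrable M (\<lambda>x. u n x * v x)"
      "integrable M (\<lambda>x. v x * v x)"
      by (simp_all add: bm u_bm v)
    have "ip (\<lambda>x. u n x - t * v x) (\<lambda>x. u n x - t * v x)
        = ip (u n) (u n) - 2 * t * ip (u n) v + t\<^sup>2 * ip v v" for t
    proof -
      have "ip (\<lambda>x. u n x - t * v x) (\<lambda>x. u n x - t * v x)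
          = (\<integral>x. u n x * u n x - 2 * t * (u n x * v x) + t\<^sup>2 * (v x * v x) \<partial>M)"
        unfolding ip_def
        by (intro Bochner_Integration.integral_cong refl) (simp add: power2_eq_square algebra_simps)
      then show ?thesis using int by (simp add: ip_def)
    qed
    moreover have "d \<le> ip (\<lambda>x. u n x - t * v x) (\<lambda>x. u n x - t * v x)" for t
      using d_le[OF lin[OF gV[of n] v, of 1 t]] by (simp add: u_def algebra_simps)
    ultimately have *: "2 * t * ip (u n) v \<le> \<epsilon> n + t\<^sup>2 * ip v v" for t
      using u_lt[of n] by (smt (verit))
    show ?thesis
    proof (cases "ip v v = 0")
      case True
      have "ip (u n) v = 0"
      proof (rule ccontr)
        assume "ip (u n) v \<noteq> 0"
        \<comment> \<open>with this step the bound reads \<open>2 * \<epsilon> n \<le> \<epsilon> n\<close>\<close>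
        then show False using *[of "\<epsilon> n / ip (u n) v"] True \<epsilon>_pos[of n] by simp
      qed
      then show ?thesis using True by simp
    next
      case False
      then have Q: "ip v v > 0" by (simp add: ip_def less_le)
      show ?thesis using *[of "ip (u n) v / ip v v"] Q
        by (simp add: field_simps power2_eq_square)
    qed
  qed

  have u_diff: "ip (\<lambda>x. u i x - u j x) (\<lambda>x. u i x - u j x)
      = ip (u i) (u i) + ip (u j) (u j) - 2 * ip (u i) (u j)" for i j
  proof -
    have "ip (\<lambda>x. u i x - u j x) (\<lambda>x. u i x - u j x)
        = (\<integral>x. u i x * u i x + u j x * u j x - 2 * (u i x * u j x) \<partial>M)"
      unfolding ip_def
      by (intro Bochner_Integration.integral_cong refl) (simp add: algebra_simps)
    then show ?thesis by (simp add: ip_def bm u_bm)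
  qed
  \<comment> \<open>The midpoint of \<open>u i\<close> and \<open>u j\<close> is again a residual, so its squared norm is at least \<open>d\<close>.\<close>
  have ip_u: "2 * ip (u i) (u j) \<ge> 2 * d - \<epsilon> i - \<epsilon> j" for i j
  proof -
    have "d \<le> ip (\<lambda>x. f x - (1/2 * g i x + 1/2 * g j x)) (\<lambda>x. f x - (1/2 * g i x + 1/2 * g j x))"
      by (rule d_le[OF lin[OF gV gV]])
    also have "\<dots> = (\<integral>x. 1/4 * (u i x * u i x) + 1/4 * (u j x * u j x) + 1/2 * (u i x * u j x) \<partial>M)"
      unfolding ip_def u_def
      by (intro Bochner_Integration.integral_cong refl) (simp add: field_simps)
    also have "\<dots> = 1/4 * ip (u i) (u i) + 1/4 * ip (u j) (u j) + 1/2 * ip (u i) (u j)"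
      by (simp add: ip_def bm u_bm)
    finally show ?thesis using u_lt[of i] u_lt[of j] by simp
  qed

  have L1_dist: "(\<integral>x. \<bar>u i x - u j x\<bar> \<partial>M)\<^sup>2 \<le> 2 * \<epsilon> i + 2 * \<epsilon> j" for i j
  proof -
    have "(\<integral>x. \<bar>u i x - u j x\<bar> \<partial>M)\<^sup>2 \<le> ip (\<lambda>x. u i x - u j x) (\<lambda>x. u i x - u j x)"
      unfolding ip_def by (intro L1_norm_le_L2_norm bm u_bm)
    then show ?thesis using u_diff[of i j] ip_u[of i j] u_lt[of i] u_lt[of j] by linarith
  qed
  have Cau: "\<exists>N. \<forall>i\<ge>N. \<forall>j\<ge>N. (\<integral>x. \<bar>u i x - u j x\<bar> \<partial>M) < a" if a: "a > 0" for a
  proof -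
    obtain N where N: "\<And>n. n \<ge> N \<Longrightarrow> \<epsilon> n < a\<^sup>2 / 4"
      using order_tendstoD(2)[OF \<epsilon>, of "a\<^sup>2 / 4"] a by (auto simp: eventually_sequentially)
    have "(\<integral>x. \<bar>u i x - u j x\<bar> \<partial>M) < a" if "i \<ge> N" "j \<ge> N" for i j
    proof (rule power2_less_imp_less)
      show "(\<integral>x. \<bar>u i x - u j x\<bar> \<partial>M)\<^sup>2 < a\<^sup>2"
        using L1_dist[of i j] N[OF that(1)] N[OF that(2)] by linarith
    qed (use a in simp)
    then show ?thesis by blast
  qed
  obtain w where w: "integrable M w" and lim: "(\<lambda>n. \<integral>x. \<bar>u n x - w x\<bar> \<partial>M) \<longlonglongrightarrow> 0"
    using L1_Cauchy_converges[of M u] Cau u_bm by auto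

  have weak: "(\<lambda>n. ip (u n) h) \<longlonglongrightarrow> ip w h" if h: "bounded_measurable M h" for h
  proof -
    obtain C where C: "\<And>x. \<bar>h x\<bar> \<le> C" using h unfolding bounded_measurable_def by blast
    have "\<bar>ip (u n) h - ip w h\<bar> \<le> C * (\<integral>x. \<bar>u n x - w x\<bar> \<partial>M)" for n
    proof -
      have int: "integrable M (\<lambda>x. (u n x - w x) * h x)"
        using w h u_bm by (intro integrable_mult_bounded_measurable) auto
      have "ip (u n) h - ip w h = (\<integral>x. (u n x - w x) * h x \<partial>M)"
        unfolding ip_def left_diff_distrib using w h u_bm
        by (subst Bochner_Integration.integral_diff) (auto intro: integrable_mult_bounded_measurable)
      also have "\<bar>\<dots>\<bar> \<le> (\<integral>x. \<bar>(u n x - w x) * h x\<bar> \<partial>M)" by (rule integral_abs_bound)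
      also have "\<dots> \<le> (\<integral>x. C * \<bar>u n x - w x\<bar> \<partial>M)"
      proof (rule integral_mono)
        show "\<bar>(u n x - w x) * h x\<bar> \<le> C * \<bar>u n x - w x\<bar>" for x
          using mult_right_mono[OF C[of x], of "\<bar>u n x - w x\<bar>"] by (simp add: abs_mult mult.commute)
      qed (use int w u_bm in auto)
      finally show ?thesis by simp
    qed
    then have "(\<lambda>n. ip (u n) h - ip w h) \<longlonglongrightarrow> 0"
      by (intro Lim_null_comparison[OF always_eventually tendsto_mult_right_zero[OF lim, of C]]) simp
    then show ?thesis by (simp add: LIM_zero_iff)
  qed

  have orth: "ip w v = 0" if v: "v \<in> V" for v
  proof -
    have "(\<lambda>n. (ip (u n) v)\<^sup>2) \<longlonglongrightarrow> (ip w v)\<^sup>2"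
      by (intro tendsto_power weak V(1) v)
    moreover have "(\<lambda>n. \<epsilon> n * ip v v) \<longlonglongrightarrow> 0"
      by (rule tendsto_mult_left_zero[OF \<epsilon>])
    ultimately have "(ip w v)\<^sup>2 \<le> 0"
      by (rule LIMSEQ_le) (use almost_orth[OF v] in blast)
    then show ?thesis by simp
  qed

  \<comment> \<open>Since \<open>w\<close> is orthogonal to \<open>g m\<close>, it pairs with \<open>f\<close> as with \<open>u m\<close>; the latter pairing is the
     limit of \<open>ip (u n) (u m)\<close>, hence at least \<open>d - \<epsilon> m / 2\<close>.\<close>
  obtain m where m: "\<epsilon> m < d"
    using order_tendstoD(2)[OF \<epsilon> d_pos] by (auto simp: eventually_sequentially)
  have "2 * d - 0 - \<epsilon> m \<le> 2 * ip w (u m)"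
  proof (rule LIMSEQ_le)
    show "(\<lambda>n. 2 * d - \<epsilon> n - \<epsilon> m) \<longlonglongrightarrow> 2 * d - 0 - \<epsilon> m" by (intro tendsto_intros \<epsilon>)
    show "(\<lambda>n. 2 * ip (u n) (u m)) \<longlonglongrightarrow> 2 * ip w (u m)" by (intro tendsto_intros weak u_bm)
  qed (use ip_u in blast)
  then have "ip w (u m) > 0" using m d_pos by linarith
  moreover have "ip w (u m) = ip w f - ip w (g m)"
    unfolding ip_def u_def right_diff_distrib using w
    by (intro Bochner_Integration.integral_diff) (auto intro: integrable_mult_bounded_measurable f V(1) gV)
  ultimately have "ip w f > 0" using orth[OF gV[of m]] by simp
  with w orth show ?thesis unfolding ip_def by (intro that) auto
qed

text \<open>Simple functions are dense, and \<open>V\<close> together with its \<open>L\<^sup>1\<close> limits is a linear space.\<close>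

lemma dense_in_L1_if_indicators_approximable:
  assumes V: "\<And>g. g \<in> V \<Longrightarrow> integrable M g"
    and lin: "\<And>g h c d. g \<in> V \<Longrightarrow> h \<in> V \<Longrightarrow> (\<lambda>x. c * g x + d * h x) \<in> V"
    and ind: "\<And>A e. A \<in> sets M \<Longrightarrow> e > 0 \<Longrightarrow> \<exists>g\<in>V. (\<integral>x. \<bar>indicator A x - g x\<bar> \<partial>M) < e"
  shows "dense_in_L1 M V"
proof -
  have "\<forall>e>0. \<exists>g\<in>V. (\<integral>x. \<bar>f x - g x\<bar> \<partial>M) < e" if "integrable M f" for f
    using that
  proof induction
    case (base A c)
    show ?case
    proof (intro allI impI)
      fix e :: real assume "e > 0"
      then obtain g where g: "g \<in> V" "(\<integral>x. \<bar>indicator A x - g x\<bar> \<partial>M) < e / (\<bar>c\<bar> + 1)"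
        using ind[OF base(1), of "e / (\<bar>c\<bar> + 1)"] by auto
      have "(\<integral>x. \<bar>indicator A x *\<^sub>R c - c * g x\<bar> \<partial>M) = (\<integral>x. \<bar>c\<bar> * \<bar>indicator A x - g x\<bar> \<partial>M)"
        by (simp add: algebra_simps flip: abs_mult)
      also have "\<dots> = \<bar>c\<bar> * (\<integral>x. \<bar>indicator A x - g x\<bar> \<partial>M)" by simp
      also have "\<dots> \<le> (\<bar>c\<bar> + 1) * (\<integral>x. \<bar>indicator A x - g x\<bar> \<partial>M)"
        by (intro mult_right_mono) auto
      also have "\<dots> < e" using g(2) by (simp add: pos_less_divide_eq mult.commute add_pos_nonneg)
      finally show "\<exists>g\<in>V. (\<integral>x. \<bar>indicator A x *\<^sub>R c - g x\<bar> \<partial>M) < e"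
        using lin[OF g(1) g(1), of c 0] by auto
    qed
  next
    case (add f1 f2)
    show ?case
    proof (intro allI impI)
      fix e :: real assume "e > 0"
      then obtain g1 g2 where g: "g1 \<in> V" "(\<integral>x. \<bar>f1 x - g1 x\<bar> \<partial>M) < e / 2"
        "g2 \<in> V" "(\<integral>x. \<bar>f2 x - g2 x\<bar> \<partial>M) < e / 2"
        using add.IH half_gt_zero by metis
      have "(\<integral>x. \<bar>f1 x + f2 x - (1 * g1 x + 1 * g2 x)\<bar> \<partial>M)
          \<le> (\<integral>x. \<bar>f1 x - g1 x\<bar> + \<bar>f2 x - g2 x\<bar> \<partial>M)"
        using add.hyps g V by (intro integral_mono) auto
      also have "\<dots> < e" using add.hyps g V by simp
      finally show "\<exists>g\<in>V. (\<integral>x. \<bar>f1 x + f2 x - g x\<bar> \<partial>M) < e"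
        using lin[OF g(1) g(3), of 1 1] by auto
    qed
  next
    case (lim f s)
    have "(\<lambda>i. \<integral>x. \<bar>s i x - f x\<bar> \<partial>M) \<longlonglongrightarrow> (\<integral>x. 0 \<partial>M)"
    proof (rule integral_dominated_convergence)
      show "integrable M (\<lambda>x. 3 * \<bar>f x\<bar>)" using lim.hyps(4) by simp
      show "AE x in M. (\<lambda>i. \<bar>s i x - f x\<bar>) \<longlonglongrightarrow> 0"
        using lim.hyps(2) by (intro AE_I2 tendsto_rabs_zero LIM_zero)
      show "AE x in M. norm \<bar>s i x - f x\<bar> \<le> 3 * \<bar>f x\<bar>" for i
      proof (rule AE_I2)
        fix x assume "x \<in> space M"
        then show "norm \<bar>s i x - f x\<bar> \<le> 3 * \<bar>f x\<bar>" using lim.hyps(3)[of x i] by simp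
      qed
    qed (use lim.hyps(1,4) in auto)
    then have conv: "(\<lambda>i. \<integral>x. \<bar>s i x - f x\<bar> \<partial>M) \<longlonglongrightarrow> 0" by simp
    show ?case
    proof (intro allI impI)
      fix e :: real assume "e > 0"
      then obtain i where i: "(\<integral>x. \<bar>s i x - f x\<bar> \<partial>M) < e / 2"
        using order_tendstoD(2)[OF conv, of "e / 2"] by (auto simp: eventually_sequentially)
      obtain g where g: "g \<in> V" "(\<integral>x. \<bar>s i x - g x\<bar> \<partial>M) < e / 2"
        using lim.IH \<open>e > 0\<close> half_gt_zero by metis
      have "(\<integral>x. \<bar>f x - g x\<bar> \<partial>M) \<le> (\<integral>x. \<bar>s i x - f x\<bar> + \<bar>s i x - g x\<bar> \<partial>M)"
        using lim.hyps(1,4) V g by (intro integral_mono) auto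
      also have "\<dots> < e" using lim.hyps(1,4) V g i by simp
      finally show "\<exists>g\<in>V. (\<integral>x. \<bar>f x - g x\<bar> \<partial>M) < e" using g(1) by auto
    qed
  qed
  then show ?thesis using V unfolding dense_in_L1_def by auto
qed

end

section \<open>The span of a class of indicators\<close>

lemma indicator_span_lincomb:
  fixes \<B> :: "'a set set"
  assumes "g \<in> indicator_span \<B>" "h \<in> indicator_span \<B>"
  shows "(\<lambda>x. c * g x + d * h x) \<in> indicator_span \<B>"
proof -
  interpret module "fun_scale :: real \<Rightarrow> ('a \<Rightarrow> real) \<Rightarrow> 'a \<Rightarrow> real" by (rule module_fun_scale)
  have "fun_scale c g + fun_scale d h \<in> indicator_span \<B>"
    using assms unfolding indicator_span_def by (intro span_add span_scale)
  then show ?thesis by (simp add: plus_fun_def)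
qed

lemma indicator_span_induct [consumes 1, case_names zero step]:
  fixes \<B> :: "'a set set"
  assumes "g \<in> indicator_span \<B>" "P (\<lambda>x. 0)"
    and "\<And>c B g. B \<in> \<B> \<Longrightarrow> P g \<Longrightarrow> P (\<lambda>x. c * indicator B x + g x)"
  shows "P g"
proof -
  interpret module "fun_scale :: real \<Rightarrow> ('a \<Rightarrow> real) \<Rightarrow> 'a \<Rightarrow> real" by (rule module_fun_scale)
  show ?thesis
    using assms(1) unfolding indicator_span_def
  proof (induction rule: span_induct_alt)
    case base then show ?case using assms(2) by (simp add: zero_fun_def)
  next
    case (step c x y) then show ?case using assms(3) by (auto simp: plus_fun_def)
  qed
qed

lemma indicator_in_indicator_span: "B \<in> \<B> \<Longrightarrow> indicator B \<in> indicator_span \<B>"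
  unfolding indicator_span_def by (intro module.span_base[OF module_fun_scale]) simp

lemma indicator_span_bounded_measurable:
  assumes "g \<in> indicator_span \<B>" "\<B> \<subseteq> sets M"
  shows "bounded_measurable M g"
  using assms(1)
proof (induction rule: indicator_span_induct)
  case zero
  show ?case by (rule bounded_measurable_const)
next
  case (step c B g)
  have "B \<in> sets M" using step.hyps assms(2) by blast
  then show ?case
    by (intro bounded_measurable_add[OF bounded_measurable_mult[OF bounded_measurable_const]]
        bounded_measurable_indicator step.IH)
qed

section \<open>Density when the balls separate\<close>

lemma open_balls_subset_borel: "open_balls \<subseteq> sets borel"
  by (auto simp: open_balls_def)

text \<open>
  The whole space is the increasing union of the balls of integer radius around any point. This is
  what allows two finite measures that agree on balls to be normalised by a common factor.
\<close>

lemma integral_zero_if_zero_on_balls: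
  fixes M :: "'a::metric_space measure"
  assumes M: "sets M = sets borel" and w: "integrable M w"
    and ball: "\<And>B. B \<in> open_balls \<Longrightarrow> (\<integral>x. w x * indicator B x \<partial>M) = (0::real)"
  shows "(\<integral>x. w x \<partial>M) = 0"
proof -
  fix a :: 'a
  have [measurable]: "w \<in> borel_measurable M" "\<And>r. ball a r \<in> sets M"
    using w M by auto
  have "(\<lambda>n. \<integral>x. w x * indicator (ball a (real (Suc n))) x \<partial>M) \<longlonglongrightarrow> (\<integral>x. w x \<partial>M)"
  proof (rule integral_dominated_convergence)
    show "integrable M (\<lambda>x. \<bar>w x\<bar>)" using w by simp
    show "AE x in M. (\<lambda>n. w x * indicator (ball a (real (Suc n))) x) \<longlonglongrightarrow> w x"
    proof (intro AE_I2 tendsto_eventually)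
      fix x
      obtain N where "dist a x < real N" using reals_Archimedean2 by blast
      then show "\<forall>\<^sub>F n in sequentially. w x * indicator (ball a (real (Suc n))) x = w x"
        by (intro eventually_sequentiallyI[of N]) simp
    qed
    show "AE x in M. norm (w x * indicator (ball a (real (Suc n))) x) \<le> \<bar>w x\<bar>" for n
      by (auto simp: indicator_def)
  qed simp_all
  moreover have "(\<integral>x. w x * indicator (ball a (real (Suc n))) x \<partial>M) = 0" for n
    by (rule ball) (force simp: open_balls_def)
  ultimately show ?thesis by (simp add: LIMSEQ_const_iff)
qed

lemma borel_prob_density:
  assumes M: "borel_prob M" and v: "integrable M v" "\<And>x. 0 \<le> v x" "(\<integral>x. v x \<partial>M) = (1::real)"
  shows "borel_prob (density M v)"
    and "A \<in> sets borel \<Longrightarrow> measure (density M v) A = (\<integral>x. v x * indicator A x \<partial>M)"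
proof -
  have [measurable]: "v \<in> borel_measurable M" using v by auto
  have sM: "sets M = sets borel" using M by (simp add: borel_prob_def)
  have "emeasure (density M v) (space (density M v)) = 1"
    using v by (simp add: emeasure_density nn_integral_eq_integral cong: nn_integral_cong)
  then show "borel_prob (density M v)" using sM by (auto simp: borel_prob_def intro!: prob_spaceI)
  show "measure (density M v) A = (\<integral>x. v x * indicator A x \<partial>M)" if "A \<in> sets borel"
  proof -
    have A: "A \<in> sets M" using that sM by simp
    have "measure (density M v) A = (\<integral>x. indicator A x \<partial>density M v)"
      using A sets.sets_into_space[OF A] by (simp add: Int_absorb2)
    also have "\<dots> = (\<integral>x. v x *\<^sub>R indicator A x \<partial>M)"
      using A v by (intro integral_density) auto
    finally show ?thesis by simp
  qed
qed

text \<open>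
  The hypothesis on \<open>w\<close> says that its positive and negative parts are densities of measures that
  agree on balls; separation applies to them once they are normalised.
\<close>

lemma zero_on_borel_if_zero_on_balls:
  fixes M :: "'a::metric_space measure"
  assumes sep: "separating_class (open_balls :: 'a set set)" and M: "borel_prob M"
    and w: "integrable M w"
    and ball: "\<And>B. B \<in> open_balls \<Longrightarrow> (\<integral>x. w x * indicator B x \<partial>M) = (0::real)"
    and A: "A \<in> sets borel"
  shows "(\<integral>x. w x * indicator A x \<partial>M) = 0"
proof -
  have sM: "sets M = sets borel" using M by (simp add: borel_prob_def)
  define p where "p x = max (w x) 0" for x
  define q where "q x = max (- w x) 0" for x
  have wpq: "w x = p x - q x" for x by (simp add: p_def q_def)
  have nonneg: "p x \<ge> 0" "q x \<ge> 0" for x by (simp_all add: p_def q_def)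
  have pq: "integrable M p" "integrable M q"
    unfolding p_def q_def using w by auto
  have pq_ind: "integrable M (\<lambda>x. p x * indicator B x)" "integrable M (\<lambda>x. q x * indicator B x)"
    if "B \<in> sets borel" for B
    using that sM pq by (auto intro!: integrable_mult_bounded_measurable bounded_measurable_indicator)
  have w_ind: "(\<integral>x. w x * indicator B x \<partial>M) = (\<integral>x. p x * indicator B x \<partial>M) - (\<integral>x. q x * indicator B x \<partial>M)"
    if "B \<in> sets borel" for B
    unfolding wpq left_diff_distrib by (rule Bochner_Integration.integral_diff[OF pq_ind[OF that]])
  define c where "c = (\<integral>x. p x \<partial>M)"
  have "(\<integral>x. w x \<partial>M) = 0" by (rule integral_zero_if_zero_on_balls[OF sM w ball])
  then have cq: "(\<integral>x. q x \<partial>M) = c" unfolding wpq c_def using pq by simp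
  show ?thesis
  proof (cases "c = 0")
    case True
    then have "AE x in M. p x = 0" "AE x in M. q x = 0"
      using cq integral_nonneg_eq_0_iff_AE[OF pq(1) AE_I2[OF nonneg(1)]]
        integral_nonneg_eq_0_iff_AE[OF pq(2) AE_I2[OF nonneg(2)]] by (simp_all add: c_def)
    then have "AE x in M. w x * indicator A x = 0" by eventually_elim (simp add: wpq)
    then show ?thesis by (rule integral_eq_zero_AE)
  next
    case False
    then have c: "c > 0" using nonneg by (simp add: c_def less_le)
    have 1: "integrable M (\<lambda>x. p x / c)" "\<And>x. 0 \<le> p x / c" "(\<integral>x. p x / c \<partial>M) = 1"
      and 2: "integrable M (\<lambda>x. q x / c)" "\<And>x. 0 \<le> q x / c" "(\<integral>x. q x / c \<partial>M) = 1"
      using c pq nonneg cq by (auto simp: c_def)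
    have "measure (density M (\<lambda>x. p x / c)) B = measure (density M (\<lambda>x. q x / c)) B"
      if "B \<in> open_balls" for B
    proof -
      have B: "B \<in> sets borel" using that open_balls_subset_borel by blast
      then show ?thesis
        using ball[OF that] w_ind[OF B] borel_prob_density(2)[OF M 1 B] borel_prob_density(2)[OF M 2 B]
        by simp
    qed
    then have "density M (\<lambda>x. p x / c) = density M (\<lambda>x. q x / c)"
      using sep borel_prob_density(1)[OF M 1] borel_prob_density(1)[OF M 2]
      unfolding separating_class_def by blast
    then show ?thesis
      using w_ind[OF A] borel_prob_density(2)[OF M 1 A] borel_prob_density(2)[OF M 2 A] c by simp
  qed
qed

lemma dense_if_separating:
  fixes M :: "'a::metric_space measure"
  assumes sep: "separating_class (open_balls :: 'a set set)" and M: "borel_prob M"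
  shows "dense_in_L1 M (indicator_span open_balls)"
proof -
  interpret prob_space M using M by (simp add: borel_prob_def)
  have sM: "sets M = sets borel" using M by (simp add: borel_prob_def)
  have bm: "bounded_measurable M g" if "g \<in> indicator_span open_balls" for g
    using that open_balls_subset_borel sM by (intro indicator_span_bounded_measurable) auto
  show ?thesis
  proof (rule dense_in_L1_if_indicators_approximable)
    show "integrable M g" if "g \<in> indicator_span open_balls" for g
      by (rule bounded_measurable_integrable[OF bm[OF that]])
    show "(\<lambda>x. c * g x + d * h x) \<in> indicator_span open_balls"
      if "g \<in> indicator_span open_balls" "h \<in> indicator_span open_balls" for g h :: "'a \<Rightarrow> real" and c d
      using that by (rule indicator_span_lincomb)
    show "\<exists>g\<in>indicator_span open_balls. (\<integral>x. \<bar>indicator A x - g x\<bar> \<partial>M) < e"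
      if A: "A \<in> sets M" and e: "e > 0" for A e
    proof (rule ccontr)
      assume "\<not> ?thesis"
      then have far: "\<And>g. g \<in> indicator_span open_balls \<Longrightarrow> e \<le> (\<integral>x. \<bar>indicator A x - g x\<bar> \<partial>M)"
        by (simp add: not_less)
      have ne: "indicator_span (open_balls :: 'a set set) \<noteq> {}"
        using indicator_in_indicator_span[of "ball (undefined :: 'a) 1" open_balls]
        by (force simp: open_balls_def)
      have "\<exists>w. integrable M w \<and> (\<forall>g\<in>indicator_span open_balls. (\<integral>x. w x * g x \<partial>M) = 0)
          \<and> (\<integral>x. w x * indicator A x \<partial>M) > 0"
      proof (rule L1_annihilator[of "indicator A" "indicator_span open_balls" e])
        show "bounded_measurable M (indicator A)" by (rule bounded_measurable_indicator[OF A])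
        show "bounded_measurable M g" if "g \<in> indicator_span open_balls" for g by (rule bm[OF that])
        show "(\<lambda>x. c * g x + d * h x) \<in> indicator_span open_balls"
          if "g \<in> indicator_span open_balls" "h \<in> indicator_span open_balls"
          for g h :: "'a \<Rightarrow> real" and c d
          by (rule indicator_span_lincomb[OF that])
        show "e \<le> (\<integral>x. \<bar>indicator A x - g x\<bar> \<partial>M)" if "g \<in> indicator_span open_balls" for g
          by (rule far[OF that])
        show "\<exists>w. integrable M w \<and> (\<forall>g\<in>indicator_span open_balls. (\<integral>x. w x * g x \<partial>M) = 0)
            \<and> (\<integral>x. w x * indicator A x \<partial>M) > 0"
          if "integrable M w" "\<And>g. g \<in> indicator_span open_balls \<Longrightarrow> (\<integral>x. w x * g x \<partial>M) = 0"
            "(\<integral>x. w x * indicator A x \<partial>M) > 0" for w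
          using that by blast
      qed (rule ne e)+
      then obtain w where w: "integrable M w"
        and orth: "\<And>g. g \<in> indicator_span open_balls \<Longrightarrow> (\<integral>x. w x * g x \<partial>M) = 0"
        and pos: "(\<integral>x. w x * indicator A x \<partial>M) > 0"
        by blast
      have "(\<integral>x. w x * indicator A x \<partial>M) = 0"
        by (rule zero_on_borel_if_zero_on_balls[OF sep M w])
           (use A sM in \<open>simp_all add: orth indicator_in_indicator_span\<close>)
      with pos show False by simp
    qed
  qed
qed

section \<open>Separation when the span is dense\<close>

text \<open>
  The average of two probability measures, realised as the law of a two-stage experiment: a fair coin
  decides which of the two to sample from.
\<close>

lemma borel_prob_mixture:
  fixes M N :: "'a::topological_space measure"
  assumes M: "borel_prob M" and N: "borel_prob N"
  shows "\<exists>K. borel_prob K \<and> (\<forall>h \<in> borel_measurable borel. (\<forall>x. 0 \<le> h x) \<longrightarrow> integrable K h \<longrightarrow>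
    (\<integral>x. h x \<partial>M) + (\<integral>x. h x \<partial>N) = 2 * (\<integral>x. h x \<partial>K :: real))"
proof -
  define C where "C = measure_pmf (pmf_of_set (UNIV :: bool set))"
  define k where "k = (\<lambda>b. if b then M else N)"
  have k: "k \<in> C \<rightarrow>\<^sub>M prob_algebra borel"
    using M N by (auto simp: C_def k_def borel_prob_def space_prob_algebra)
  have C: "C \<in> space (prob_algebra (count_space UNIV))"
    by (simp add: C_def space_prob_algebra prob_space_measure_pmf)
  have k': "k \<in> count_space UNIV \<rightarrow>\<^sub>M prob_algebra borel" using k by (simp add: C_def)
  define K where "K = C \<bind> k"
  have K: "borel_prob K"
    using prob_space_bind'[OF C k'] sets_bind'[OF C k'] by (simp add: K_def borel_prob_def)
  have nn: "(\<integral>\<^sup>+x. ennreal (h x) \<partial>K) * 2 = (\<integral>\<^sup>+x. ennreal (h x) \<partial>M) + (\<integral>\<^sup>+x. ennreal (h x) \<partial>N)"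
    if h: "h \<in> borel_measurable borel" for h :: "'a \<Rightarrow> real"
  proof -
    have "(\<integral>\<^sup>+x. ennreal (h x) \<partial>K) = (\<integral>\<^sup>+b. \<integral>\<^sup>+x. ennreal (h x) \<partial>k b \<partial>C)"
      unfolding K_def using h by (intro nn_integral_bind[where B=borel] measurable_prob_algebraD[OF k]) simp
    also have "\<dots> = ((\<integral>\<^sup>+x. ennreal (h x) \<partial>M) + (\<integral>\<^sup>+x. ennreal (h x) \<partial>N)) / 2"
      by (simp add: C_def nn_integral_pmf_of_set UNIV_bool k_def add.commute)
    finally show ?thesis by (simp add: ennreal_divide_times)
  qed
  show ?thesis
  proof (intro exI[of _ K] conjI ballI impI K)
    fix h :: "'a \<Rightarrow> real"
    assume h: "h \<in> borel_measurable borel" "\<forall>x. 0 \<le> h x" "integrable K h"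
    have meas: "h \<in> borel_measurable M" "h \<in> borel_measurable N"
      using h(1) M N by (auto simp: borel_prob_def cong: measurable_cong_sets)
    have eq: "ennreal (2 * (\<integral>x. h x \<partial>K)) = (\<integral>\<^sup>+x. ennreal (h x) \<partial>M) + (\<integral>\<^sup>+x. ennreal (h x) \<partial>N)"
      using nn[OF h(1)] h by (simp add: nn_integral_eq_integral ennreal_mult' mult.commute)
    then have "(\<integral>\<^sup>+x. ennreal (h x) \<partial>M) + (\<integral>\<^sup>+x. ennreal (h x) \<partial>N) < \<infinity>"
      by (metis ennreal_less_top infinity_ennreal_def)
    then have int: "integrable M h" "integrable N h"
      using meas h(2) by (auto intro!: integrableI_nonneg)
    then have "ennreal (2 * (\<integral>x. h x \<partial>K)) = ennreal ((\<integral>x. h x \<partial>M) + (\<integral>x. h x \<partial>N))"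
      using eq h(2) by (simp add: nn_integral_eq_integral)
    then show "(\<integral>x. h x \<partial>M) + (\<integral>x. h x \<partial>N) = 2 * (\<integral>x. h x \<partial>K)"
      using h(2) by (subst (asm) ennreal_inj) auto
  qed
qed

text \<open>
  Density is applied to a single measure, the average \<open>K\<close>, to get one function that is close to \<open>indicator A\<close> for both \<open>M\<close> and \<open>N\<close>.
\<close>

lemma separating_if_dense:
  assumes \<B>: "\<B> \<subseteq> sets (borel :: 'a::topological_space measure)"
    and dense: "\<And>M :: 'a measure. borel_prob M \<Longrightarrow> dense_in_L1 M (indicator_span \<B>)"
  shows "separating_class \<B>"
  unfolding separating_class_def
proof (intro allI impI)
  fix M N :: "'a measure"
  assume M: "borel_prob M" and N: "borel_prob N" and eq: "\<forall>B\<in>\<B>. measure M B = measure N B"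
  interpret M: prob_space M using M by (simp add: borel_prob_def)
  interpret N: prob_space N using N by (simp add: borel_prob_def)
  have sM: "sets M = sets borel" "sets N = sets borel" using M N by (auto simp: borel_prob_def)
  have sp: "space M = UNIV" "space N = UNIV"
    using sM[THEN sets_eq_imp_space_eq] by simp_all
  have bm: "bounded_measurable M g" "bounded_measurable N g" "bounded_measurable borel g"
    if "g \<in> indicator_span \<B>" for g
    using that \<B> sM by (auto intro: indicator_span_bounded_measurable)
  have span_eq: "(\<integral>x. g x \<partial>M) = (\<integral>x. g x \<partial>N)" if "g \<in> indicator_span \<B>" for g
  proof -
    have "bounded_measurable M g \<and> bounded_measurable N g \<and> (\<integral>x. g x \<partial>M) = (\<integral>x. g x \<partial>N)"
      using that
    proof (induction rule: indicator_span_induct)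
      case zero then show ?case by (simp add: bounded_measurable_const)
    next
      case (step c B g)
      then have B: "B \<in> sets M" "B \<in> sets N" using \<B> sM by auto
      note ind = B[THEN bounded_measurable_indicator]
      have "(\<integral>x. c * indicator B x + g x \<partial>M) = c * measure M B + (\<integral>x. g x \<partial>M)"
        using step.IH M.bounded_measurable_integrable[of g] M.bounded_measurable_integrable[OF ind(1)] sp
        by simp
      moreover have "(\<integral>x. c * indicator B x + g x \<partial>N) = c * measure N B + (\<integral>x. g x \<partial>N)"
        using step.IH N.bounded_measurable_integrable[of g] N.bounded_measurable_integrable[OF ind(2)] sp
        by simp
      ultimately show ?case
        using step.IH step.hyps eq ind
        by (simp add: bounded_measurable_add bounded_measurable_mult bounded_measurable_const)
    qed
    then show ?thesis by simp
  qed
  obtain K where K: "borel_prob K" and mix: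
    "\<forall>h \<in> borel_measurable borel. (\<forall>x. 0 \<le> h x) \<longrightarrow> integrable K h \<longrightarrow>
      (\<integral>x. h x \<partial>M) + (\<integral>x. h x \<partial>N) = 2 * (\<integral>x. h x \<partial>K :: real)"
    using borel_prob_mixture[OF M N] by blast
  interpret K: prob_space K using K by (simp add: borel_prob_def)
  have sK: "sets K = sets borel" using K by (simp add: borel_prob_def)
  have "measure M A = measure N A" if A: "A \<in> sets borel" for A
  proof -
    have close: "\<bar>measure M A - measure N A\<bar> \<le> 0 + e" if "e > 0" for e
    proof -
      have iK: "integrable K (indicator A :: 'a \<Rightarrow> real)"
        using A sK by (intro K.bounded_measurable_integrable bounded_measurable_indicator) auto
      obtain g where g: "g \<in> indicator_span \<B>" "(\<integral>x. \<bar>indicator A x - g x\<bar> \<partial>K) < e / 2"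
        using dense[OF K] iK \<open>e > 0\<close> half_gt_zero[OF \<open>e > 0\<close>] unfolding dense_in_L1_def by blast
      have g_int: "integrable M g" "integrable N g" "integrable K g"
        using bm[OF g(1)] dense[OF K] g(1)
        by (auto simp: M.bounded_measurable_integrable N.bounded_measurable_integrable dense_in_L1_def)
      have A_int: "integrable M (indicator A :: 'a \<Rightarrow> real)" "integrable N (indicator A :: 'a \<Rightarrow> real)"
        using A sM by (auto intro!: M.bounded_measurable_integrable N.bounded_measurable_integrable bounded_measurable_indicator)
      have "(\<lambda>x. \<bar>indicator A x - g x\<bar>) \<in> borel_measurable borel"
        using A bm(3)[OF g(1)] by (auto simp: bounded_measurable_def)
      then have "(\<integral>x. \<bar>indicator A x - g x\<bar> \<partial>M) + (\<integral>x. \<bar>indicator A x - g x\<bar> \<partial>N)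
          = 2 * (\<integral>x. \<bar>indicator A x - g x\<bar> \<partial>K)"
        using iK g_int by (intro mix[rule_format]) auto
      moreover have "\<bar>measure M A - (\<integral>x. g x \<partial>M)\<bar> \<le> (\<integral>x. \<bar>indicator A x - g x\<bar> \<partial>M)"
        using integral_abs_bound[of M "\<lambda>x. indicator A x - g x"] g_int A_int sp by simp
      moreover have "\<bar>measure N A - (\<integral>x. g x \<partial>N)\<bar> \<le> (\<integral>x. \<bar>indicator A x - g x\<bar> \<partial>N)"
        using integral_abs_bound[of N "\<lambda>x. indicator A x - g x"] g_int A_int sp by simp
      ultimately show ?thesis using span_eq[OF g(1)] g(2) by linarith
    qed
    have "\<bar>measure M A - measure N A\<bar> \<le> 0" by (rule field_le_epsilon[OF close])
    then show ?thesis by simp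
  qed
  then show "M = N"
    using sM by (intro measure_eqI) (auto simp: M.emeasure_eq_measure N.emeasure_eq_measure)
qed

section \<open>The equivalence\<close>

theorem lemma2p1:
  assumes "separable_space (euclidean :: 'a::metric_space topology)"
  shows "(\<forall>M :: 'a measure. borel_prob M \<longrightarrow> dense_in_L1 M (indicator_span open_balls))
     \<longleftrightarrow> separating_class (open_balls :: 'a set set)"
  using separating_if_dense[OF open_balls_subset_borel] dense_if_separating by blast

end
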